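(* Let $v_1,\ldots,v_d\in\mathbb R^d$ be linearly independent vectors satisfying $\langle v_i,v_j\rangle=\frac1{\lambda_0}+\frac{\delta_{ij}}{\lambda_i}$ for all $i,j\in\{1,\ldots,d\}$, for some $\lambda_0,\lambda_1,\ldots,\lambda_d\in\mathbb R\setminus\{0\}$, let $\varepsilon_1,\ldots,\varepsilon_d\in\{\pm1\}$, and consider the cone $C:=\operatorname{pos}(\varepsilon_1v_1,\ldots,\varepsilon_dv_d)$. Let $k\in\{1,\ldots,d-1\}$. Then the normal cone $N(F,C)$ of $C$ at its face $F:=\operatorname{pos}(\varepsilon_1v_1,\ldots,\varepsilon_kv_k)$ is isometric to $$C_{d-k}\bigl(-\lambda_0-\lambda_1-\cdots-\lambda_d;\ \lambda_{k+1},\ldots,\lambda_d;\ \varepsilon_{k+1}\operatorname{sgn}(\lambda_{k+1}),\ldots,\varepsilon_d\operatorname{sgn}(\lambda_d)\bigr).$$ Furthermore, the tangent cone of $C$ at $F$ can be represented as a direct orthogonal sum $T(F,C)=L\oplus D$ of its lineality space $L=\operatorname{lin}(v_1,\ldots,v_k)$ and a pointed cone $D$ isometric to $$C_{d-k}\bigl(\lambda_0+\lambda_1+\cdots+\lambda_k;\ \lambda_{k+1},\ldots,\lambda_d;\ \varepsilon_{k+1},\ldots,\varepsilon_d\bigr).$$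
   Context: $\operatorname{pos}$ and $\operatorname{lin}$ denote positive hull and linear hull; $\delta_{ij}$ is the Kronecker delta. For a face $F$ of a polyhedron $P\subseteq\mathbb R^d$ and $x_0$ in the relative interior of $F$, the tangent cone is $T(F,P)=\{v\in\mathbb R^d:x_0+\varepsilon v\in P\text{ for some }\varepsilon>0\}$ and the normal cone is its polar $N(F,P)=\{v\in\mathbb R^d:\langle v,z-x_0\rangle\le0\text{ for all }z\in P\}$. The lineality space of a cone is the largest linear subspace contained in it; a cone is pointed if its lineality space is $\{0\}$. Orthocentric cone: $C_m(\lambda_0;\lambda_1,\ldots,\lambda_m;\varepsilon_1,\ldots,\varepsilon_m):=\operatorname{pos}(\varepsilon_1u_1,\ldots,\varepsilon_mu_m)$, where $u_1,\ldots,u_m$ are linearly independent vectors in some $\mathbb R^N$, $N\ge m$, with $\langle u_i,u_j\rangle=\frac1{\lambda_0}+\frac{\delta_{ij}}{\lambda_i}$ for all $i,j$; here $\lambda_0,\ldots,\lambda_m\in\mathbb R\setminus\{0\}$ and $\varepsilon_i\in\{\pm1\}$. It is defined up to isometry, and exists exactly when either all $\lambda_0,\ldots,\lambda_m$ are positive, or exactly one of them is negative, all others are positive and $\lambda_0+\cdots+\lambda_m<0$. *)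

theory Defs
  imports "HOL-Analysis.Analysis"
begin

section \<open>Tangent and normal cones\<close>

text \<open>Both cones are formed at an arbitrarily chosen point of the relative interior of the face;
  the lemmas \<open>tangent_cone_eq\<close> and \<open>normal_cone_eq\<close> show that the choice is immaterial.\<close>

definition relint_point :: "'a::euclidean_space set \<Rightarrow> 'a" where
  "relint_point F = (SOME x. x \<in> rel_interior F)"

definition tangent_cone :: "'a::euclidean_space set \<Rightarrow> 'a set \<Rightarrow> 'a set" where
  "tangent_cone F P = {v. \<exists>\<epsilon>>0. relint_point F + \<epsilon> *\<^sub>R v \<in> P}"

definition normal_cone :: "'a::euclidean_space set \<Rightarrow> 'a set \<Rightarrow> 'a set" where
  "normal_cone F P = {v. \<forall>z\<in>P. v \<bullet> (z - relint_point F) \<le> 0}"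

lemma relint_point_in: "x0 \<in> rel_interior F \<Longrightarrow> relint_point F \<in> rel_interior F"
  unfolding relint_point_def by (rule someI)

lemma rel_interior_prolong:
  fixes F :: "'a::euclidean_space set"
  assumes "convex F" "x \<in> rel_interior F" "y \<in> F"
  obtains e where "e > 0" "x + e *\<^sub>R (x - y) \<in> F"
proof -
  obtain m where "m > 1" "(1 - m) *\<^sub>R y + m *\<^sub>R x \<in> F"
    using convex_rel_interior_iff[of F x] assms by auto
  moreover have "(1 - m) *\<^sub>R y + m *\<^sub>R x = x + (m - 1) *\<^sub>R (x - y)"
    by (simp add: algebra_simps)
  ultimately show ?thesis using that[of "m - 1"] by auto
qed

lemma tangent_directions_mono:
  fixes F P :: "'a::euclidean_space set"
  assumes "convex F" "convex P" "F \<subseteq> P" "x \<in> rel_interior F" "y \<in> F"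
    and "\<epsilon> > 0" "y + \<epsilon> *\<^sub>R v \<in> P"
  shows "\<exists>\<delta>>0. x + \<delta> *\<^sub>R v \<in> P"
proof -
  obtain e where e: "e > 0" "x + e *\<^sub>R (x - y) \<in> F"
    using rel_interior_prolong assms(1,4,5) by blast
  define t where "t = e / (1 + e)"
  have t: "0 < t" "t < 1" and te: "(1 - t) * e = t" "(1 - t) * (1 + e) = 1"
    using e(1) by (auto simp: t_def field_simps)
  have "(1 - t) *\<^sub>R (x + e *\<^sub>R (x - y)) + t *\<^sub>R (y + \<epsilon> *\<^sub>R v) \<in> P"
    using assms(2,3,7) e(2) t by (intro convexD) auto
  also have "(1 - t) *\<^sub>R (x + e *\<^sub>R (x - y)) + t *\<^sub>R (y + \<epsilon> *\<^sub>R v)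
      = ((1 - t) * (1 + e)) *\<^sub>R x + (t - (1 - t) * e) *\<^sub>R y + (t * \<epsilon>) *\<^sub>R v"
    by (simp add: algebra_simps)
  also have "\<dots> = x + (t * \<epsilon>) *\<^sub>R v"
    by (simp add: te)
  finally show ?thesis using t assms(6) by (intro exI[of _ "t * \<epsilon>"]) auto
qed

lemma tangent_cone_eq:
  assumes "convex F" "convex P" "F \<subseteq> P" "x0 \<in> rel_interior F"
  shows "tangent_cone F P = {v. \<exists>\<epsilon>>0. x0 + \<epsilon> *\<^sub>R v \<in> P}"
proof -
  have p: "relint_point F \<in> rel_interior F" using relint_point_in assms(4) .
  have "relint_point F \<in> F" "x0 \<in> F" using p assms(4) rel_interior_subset by blast+
  then show ?thesis unfolding tangent_cone_def
    using tangent_directions_mono[OF assms(1-3)] p assms(4) by blast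
qed

lemma normal_cone_eq:
  assumes "convex F" "F \<subseteq> P" "x0 \<in> rel_interior F"
  shows "normal_cone F P = {v. \<forall>z\<in>P. v \<bullet> (z - x0) \<le> 0}"
proof -
  have *: "v \<bullet> (z - y) \<le> 0"
    if xy: "x \<in> rel_interior F" "y \<in> rel_interior F" and v: "\<forall>z\<in>P. v \<bullet> (z - x) \<le> 0" "z \<in> P"
    for x y z v
  proof -
    have "y \<in> F" using xy(2) rel_interior_subset by blast
    then obtain e where e: "e > 0" "x + e *\<^sub>R (x - y) \<in> F"
      using rel_interior_prolong[OF assms(1) xy(1)] by blast
    then have "v \<bullet> (e *\<^sub>R (x - y)) \<le> 0" using v(1) assms(2) by force
    then have "v \<bullet> (x - y) \<le> 0" using e(1) by (simp add: mult_le_0_iff)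
    moreover have "v \<bullet> (z - x) \<le> 0" using v by blast
    ultimately show ?thesis by (simp add: inner_diff_right)
  qed
  show ?thesis unfolding normal_cone_def
    using *[OF assms(3) relint_point_in[OF assms(3)]]
      *[OF relint_point_in[OF assms(3)] assms(3)] by blast
qed

section \<open>Lineality space\<close>

text \<open>Here \<open>GREATEST\<close> refers to set inclusion; for a convex cone the greatest subspace exists.\<close>

definition lineality_space :: "'a::euclidean_space set \<Rightarrow> 'a set" where
  "lineality_space K = (GREATEST S. subspace S \<and> S \<subseteq> K)"

lemma lineality_space_convex_cone:
  assumes "convex_cone K"
  shows "lineality_space K = {x \<in> K. - x \<in> K}"
  unfolding lineality_space_def
proof (rule Greatest_equality)
  have scale: "c *\<^sub>R x \<in> K" if "x \<in> K" "- x \<in> K" for c x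
  proof (cases "c \<ge> 0")
    case False
    then show ?thesis using convex_cone_scaleR[OF assms, of "- c" "- x"] that by simp
  next
    case True
    then show ?thesis using convex_cone_scaleR[OF assms] that(1) by simp
  qed
  have "subspace {x \<in> K. - x \<in> K}"
  proof (rule subspaceI)
    show "0 \<in> {x \<in> K. - x \<in> K}" using convex_cone_contains_0[OF assms] by simp
  next
    fix x y assume "x \<in> {x \<in> K. - x \<in> K}" "y \<in> {x \<in> K. - x \<in> K}"
    then show "x + y \<in> {x \<in> K. - x \<in> K}"
      using convex_cone_add[OF assms, of x y] convex_cone_add[OF assms, of "- x" "- y"] by simp
  next
    fix c x assume "x \<in> {x \<in> K. - x \<in> K}"
    then show "c *\<^sub>R x \<in> {x \<in> K. - x \<in> K}"
      using scale[of x c] scale[of x "- c"] by simp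
  qed
  then show "subspace {x \<in> K. - x \<in> K} \<and> {x \<in> K. - x \<in> K} \<subseteq> K" by auto
next
  fix S assume "subspace S \<and> S \<subseteq> K"
  then show "S \<subseteq> {x \<in> K. - x \<in> K}" using subspace_neg by auto
qed

definition pointed_cone :: "'a::euclidean_space set \<Rightarrow> bool" where
  "pointed_cone K \<longleftrightarrow> convex_cone K \<and> lineality_space K = {0}"

section \<open>Direct orthogonal sums\<close>

text \<open>The bijection says that every element of \<open>T\<close> is uniquely a sum of an element of \<open>L\<close> and an
  element of \<open>D\<close>, and that all such sums belong to \<open>T\<close>.\<close>

definition direct_orthogonal_sum ::
  "'a::euclidean_space set \<Rightarrow> 'a set \<Rightarrow> 'a set \<Rightarrow> bool" where
  "direct_orthogonal_sum T L D \<longleftrightarrow>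
     (\<forall>x\<in>L. \<forall>y\<in>D. x \<bullet> y = 0) \<and> bij_betw (\<lambda>(x, y). x + y) (L \<times> D) T"

section \<open>Isometric cones and orthocentric cones\<close>

text \<open>The ambient spaces may have different dimensions, so the linear map is only required to be
  norm-preserving on the linear hull of the first cone.\<close>

definition isometric_cones ::
  "'a::euclidean_space set \<Rightarrow> 'b::euclidean_space set \<Rightarrow> bool" where
  "isometric_cones A B \<longleftrightarrow>
     (\<exists>f. linear f \<and> (\<forall>x\<in>span A. norm (f x) = norm x) \<and> f ` A = B)"

text \<open>Family version of linear independence together with the Gram matrix condition; only the
  values \<open>u 1, \<dots>, u m\<close> and \<open>l 1, \<dots>, l m\<close> matter.\<close>

definition orthocentric_family ::
  "nat \<Rightarrow> real \<Rightarrow> (nat \<Rightarrow> real) \<Rightarrow> (nat \<Rightarrow> 'a::euclidean_space) \<Rightarrow> bool" where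
  "orthocentric_family m l0 l u \<longleftrightarrow>
     l0 \<noteq> 0 \<and> (\<forall>i\<in>{1..m}. l i \<noteq> 0) \<and>
     inj_on u {1..m} \<and> independent (u ` {1..m}) \<and>
     (\<forall>i\<in>{1..m}. \<forall>j\<in>{1..m}. u i \<bullet> u j = 1 / l0 + (if i = j then 1 / l i else 0))"

text \<open>\<open>K\<close> is a realisation of the cone \<open>C\<^sub>m(l0; l 1, \<dots>, l m; e 1, \<dots>, e m)\<close>. This is a
  predicate because the cone is defined only up to isometry and only for some parameters;
  the positive hull is the \<open>convex_cone hull\<close>.\<close>

definition orthocentric_cone ::
  "nat \<Rightarrow> real \<Rightarrow> (nat \<Rightarrow> real) \<Rightarrow> (nat \<Rightarrow> real) \<Rightarrow> 'a::euclidean_space set \<Rightarrow> bool" where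
  "orthocentric_cone m l0 l e K \<longleftrightarrow>
     (\<forall>i\<in>{1..m}. e i \<in> {1, -1}) \<and>
     (\<exists>u. orthocentric_family m l0 l u \<and>
          K = convex_cone hull ((\<lambda>i. e i *\<^sub>R u i) ` {1..m}))"

end

theory Submission
  imports Defs
begin

text \<open>Write \<open>s k = l0 + l 1 + \<dots> + l k\<close> and let \<open>w k = (l 1 v 1 + \<dots> + l k v k) / s k\<close> (the sum \<open>s k\<close> is
  nonzero because otherwise \<open>l 1 v 1 + \<dots> + l k v k\<close> would be orthogonal to \<open>v 1, \<dots>, v k\<close>). The Gram
  condition says that \<open>w k\<close> is the orthogonal projection of every \<open>v j\<close> with \<open>j > k\<close> onto
  \<open>lin (v 1, \<dots>, v k)\<close>, and that the vectors \<open>l j (v j - w d)\<close> form the basis dual to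
  \<open>v 1, \<dots>, v d\<close>. In these dual coordinates tangent and normal cone are given by sign conditions:
  the normal cone is generated by the vectors \<open>\<epsilon> j sgn (l j) (w d - v j)\<close> with \<open>j > k\<close>, and the
  tangent cone is the orthogonal sum of \<open>lin (v 1, \<dots>, v k)\<close> and the cone generated by the
  \<open>\<epsilon> j (v j - w k)\<close> with \<open>j > k\<close>. Both families have the required Gram matrices.\<close>

section \<open>Biorthogonal families\<close>

text \<open>Pairing with \<open>w j\<close> reads off the coefficient of \<open>u j\<close>. The
  \<open>w j\<close> may lie outside the span of the \<open>u i\<close>, so the notion passes to
  subfamilies of a basis.\<close>

locale biorthogonal =
  fixes I :: "'i set" and u w :: "'i \<Rightarrow> 'a::euclidean_space"
  assumes finite_I: "finite I"
    and inner: "\<And>i j. i \<in> I \<Longrightarrow> j \<in> I \<Longrightarrow> u i \<bullet> w j = (if i = j then 1 else 0)"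
begin

lemma inner_sum_left: "j \<in> I \<Longrightarrow> (\<Sum>i\<in>I. c i *\<^sub>R u i) \<bullet> w j = c j"
proof -
  assume j: "j \<in> I"
  have "(\<Sum>i\<in>I. c i *\<^sub>R u i) \<bullet> w j = (\<Sum>i\<in>I. if i = j then c i else 0)"
    using j by (auto simp: Inner_Product.inner_sum_left inner intro!: sum.cong)
  then show ?thesis
    using j finite_I by simp
qed

lemma inj: "inj_on u I"
proof (rule inj_onI)
  fix i j assume "i \<in> I" "j \<in> I" "u i = u j"
  then show "i = j"
    using inner[of i j] inner[of j j] by (auto split: if_splits)
qed

lemma expand:
  assumes "x \<in> span (u ` I)"
  shows "x = (\<Sum>i\<in>I. (x \<bullet> w i) *\<^sub>R u i)"
proof -
  obtain c where "x = (\<Sum>y\<in>u ` I. c y *\<^sub>R y)"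
    using assms finite_I by (auto simp: span_finite)
  then have x: "x = (\<Sum>i\<in>I. c (u i) *\<^sub>R u i)"
    by (simp add: sum.reindex[OF inj])
  have "c (u i) = x \<bullet> w i" if "i \<in> I" for i
    unfolding x using inner_sum_left[OF that] by simp
  then show ?thesis
    by (subst x) (simp cong: sum.cong)
qed

lemma independent: "independent (u ` I)"
proof (rule independent_if_scalars_zero)
  fix f x assume "(\<Sum>y\<in>u ` I. f y *\<^sub>R y) = 0" and x: "x \<in> u ` I"
  then have sum: "(\<Sum>i\<in>I. f (u i) *\<^sub>R u i) = 0"
    by (simp add: sum.reindex[OF inj])
  obtain i where i: "i \<in> I" "x = u i"
    using x by blast
  show "f x = 0"
    using inner_sum_left[OF i(1), of "\<lambda>i. f (u i)"] by (simp add: sum i(2))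
qed (simp add: finite_I)

text \<open>The inequality form of a simplicial cone: the numbers \<open>x \<bullet> w j\<close> are
  the coefficients in \<open>expand\<close>, so lying in the hull means that all of them are
  nonnegative.\<close>

lemma convex_cone_hull_eq:
  "convex_cone hull (u ` I) = {x \<in> span (u ` I). \<forall>j\<in>I. 0 \<le> x \<bullet> w j}"
    (is "?H = ?R")
proof
  have "convex_cone ?R"
    by (auto simp: convex_cone_iff span_zero span_add span_scale inner_left_distrib)
  moreover have "u ` I \<subseteq> ?R"
    by (auto simp: span_base inner)
  ultimately show "?H \<subseteq> ?R"
    by (simp add: hull_minimal)
next
  have sums: "(\<Sum>i\<in>J. c i *\<^sub>R u i) \<in> ?H" if "J \<subseteq> I" "\<And>i. i \<in> J \<Longrightarrow> 0 \<le> c i" for J c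
    using finite_subset[OF that(1) finite_I] that
  proof (induction J rule: finite_induct)
    case empty
    then show ?case by (simp add: convex_cone_hull_contains_0)
  next
    case (insert i J)
    moreover have "u i \<in> ?H"
      using insert.prems by (simp add: hull_inc)
    ultimately show ?case
      by (simp add: convex_cone_hull_add convex_cone_hull_mul)
  qed
  show "?R \<subseteq> ?H"
  proof
    fix x assume x: "x \<in> ?R"
    then have "x = (\<Sum>i\<in>I. (x \<bullet> w i) *\<^sub>R u i)"
      using expand by blast
    then show "x \<in> ?H"
      using sums[of I "\<lambda>i. x \<bullet> w i"] x by auto
  qed
qed

lemma pointed: "pointed_cone (convex_cone hull (u ` I))"
proof -
  have "x = 0" if "x \<in> convex_cone hull (u ` I)" "- x \<in> convex_cone hull (u ` I)" for x
  proof -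
    have "x \<in> span (u ` I)" "\<forall>j\<in>I. x \<bullet> w j = 0"
      using that by (force simp: convex_cone_hull_eq)+
    then show ?thesis
      using expand by fastforce
  qed
  moreover have "0 \<in> convex_cone hull (u ` I)"
    by (rule convex_cone_hull_contains_0)
  ultimately show ?thesis
    unfolding pointed_cone_def
    by (auto simp: convex_cone_convex_cone_hull lineality_space_convex_cone)
qed

lemma subfamily: "J \<subseteq> I \<Longrightarrow> biorthogonal J u w"
  using finite_I inner finite_subset by unfold_locales blast+

lemma span_UNIV: "card I = DIM('a) \<Longrightarrow> span (u ` I) = UNIV"
  by (metis card_image dim_eq_full dim_eq_card_independent independent inj)

text \<open>The whole family is now a basis, so the span of a subfamily is cut out by the vanishing
  of the remaining coordinates alone.\<close>

lemma span_subfamily: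
  assumes "card I = DIM('a)" "J \<subseteq> I"
  shows "span (u ` J) = {x. \<forall>j\<in>I - J. x \<bullet> w j = 0}" (is "_ = ?R")
proof
  have "subspace ?R"
    by (auto simp: subspace_def inner_left_distrib)
  moreover have "u ` J \<subseteq> ?R"
    using assms by (auto simp: inner)
  ultimately show "span (u ` J) \<subseteq> ?R"
    by (simp add: span_minimal)
next
  show "?R \<subseteq> span (u ` J)"
  proof
    fix x assume x: "x \<in> ?R"
    have "x = (\<Sum>i\<in>I. (x \<bullet> w i) *\<^sub>R u i)"
      using expand span_UNIV[OF assms(1)] by blast
    also have "\<dots> = (\<Sum>i\<in>J. (x \<bullet> w i) *\<^sub>R u i)"
      using x assms(2) finite_I by (intro sum.mono_neutral_right) auto
    also have "\<dots> \<in> span (u ` J)"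
      by (intro span_sum span_scale span_base) auto
    finally show "x \<in> span (u ` J)" .
  qed
qed

lemma convex_cone_hull_subfamily:
  assumes "card I = DIM('a)" "J \<subseteq> I"
  shows "convex_cone hull (u ` J) = {x. (\<forall>j\<in>J. 0 \<le> x \<bullet> w j) \<and> (\<forall>j\<in>I - J. x \<bullet> w j = 0)}"
  using biorthogonal.convex_cone_hull_eq[OF subfamily[OF assms(2)]] span_subfamily[OF assms]
  by auto

end

section \<open>Faces of simplicial cones\<close>

text \<open>In the dual coordinates \<open>C\<close> is the nonnegative orthant and \<open>F\<close>
  its coordinate face belonging to \<open>J\<close>.\<close>

locale simplicial_cone = biorthogonal I u w
  for I :: "'i set" and u w :: "'i \<Rightarrow> 'a::euclidean_space" +
  fixes J :: "'i set" and C F :: "'a set"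
  assumes card_I: "card I = DIM('a)" and J_subset: "J \<subseteq> I"
    and C_def: "C = convex_cone hull (u ` I)" and F_def: "F = convex_cone hull (u ` J)"
begin

lemma cone_eq: "C = {x. \<forall>j\<in>I. 0 \<le> x \<bullet> w j}"
  using convex_cone_hull_subfamily[OF card_I subset_refl] by (simp add: C_def)

lemma face_eq: "F = {x. (\<forall>j\<in>J. 0 \<le> x \<bullet> w j) \<and> (\<forall>j\<in>I - J. x \<bullet> w j = 0)}"
  using convex_cone_hull_subfamily[OF card_I J_subset] by (simp add: F_def)

text \<open>The sum of the \<open>w j\<close> over \<open>I - J\<close> is a functional that is
  nonnegative on \<open>C\<close> and vanishes on \<open>C\<close> exactly along \<open>F\<close>,
  so it exposes \<open>F\<close>.\<close>

lemma face_of_cone: "F face_of C"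
proof -
  let ?n = "\<Sum>j\<in>I - J. w j"
  have n: "?n \<bullet> x = (\<Sum>j\<in>I - J. x \<bullet> w j)" for x
    unfolding inner_commute[of ?n] by (rule inner_sum_right)
  have nonneg: "\<And>j. j \<in> I - J \<Longrightarrow> 0 \<le> x \<bullet> w j" if "x \<in> C" for x
    using that by (simp add: cone_eq)
  have "convex C"
    unfolding C_def by (rule convex_convex_cone_hull)
  then have "C \<inter> {x. ?n \<bullet> x = 0} face_of C"
    unfolding n by (rule face_of_Int_supporting_hyperplane_ge[of C 0 ?n, unfolded n])
      (intro sum_nonneg nonneg)
  moreover have "?n \<bullet> x = 0 \<longleftrightarrow> (\<forall>j\<in>I - J. x \<bullet> w j = 0)" if "x \<in> C" for x
    unfolding n using finite_I nonneg[OF that] by (intro sum_nonneg_eq_0_iff) auto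
  then have "C \<inter> {x. ?n \<bullet> x = 0} = C \<inter> {x. \<forall>j\<in>I - J. x \<bullet> w j = 0}"
    by blast
  moreover have "F = C \<inter> {x. \<forall>j\<in>I - J. x \<bullet> w j = 0}"
  proof (intro equalityI subsetI)
    fix x assume "x \<in> F"
    then have "0 \<le> x \<bullet> w j" if "j \<in> I" for j
      using that by (cases "j \<in> J") (auto simp: face_eq)
    then show "x \<in> C \<inter> {x. \<forall>j\<in>I - J. x \<bullet> w j = 0}"
      using \<open>x \<in> F\<close> by (simp add: cone_eq face_eq)
  qed (use J_subset in \<open>auto simp: cone_eq face_eq\<close>)
  ultimately show ?thesis by simp
qed

text \<open>The chosen point is unspecified; the signs of its coordinates are all that the cone
  computations use.\<close>

lemma relint_point_face:
  shows "j \<in> J \<Longrightarrow> 0 < relint_point F \<bullet> w j" and "j \<in> I - J \<Longrightarrow> relint_point F \<bullet> w j = 0"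
proof -
  let ?p = "relint_point F"
  have conv: "convex F" and "F \<noteq> {}"
    unfolding F_def by (rule convex_convex_cone_hull convex_cone_hull_nonempty)+
  then obtain x where "x \<in> rel_interior F"
    using rel_interior_eq_empty by blast
  then have ri: "?p \<in> rel_interior F"
    by (rule relint_point_in)
  then have "?p \<in> F"
    using rel_interior_subset by blast
  then show "j \<in> I - J \<Longrightarrow> ?p \<bullet> w j = 0"
    by (simp add: face_eq)
  assume j: "j \<in> J"
  \<comment> \<open>Prolonging the segment from \<open>?p + u j\<close> beyond \<open>?p\<close>
    stays in \<open>F\<close>. At the new point the \<open>j\<close>-th coordinate is
    \<open>?p \<bullet> w j - e\<close>, and it is still nonnegative.\<close>
  have "?p + u j \<in> F"
    using \<open>?p \<in> F\<close> j convex_cone_hull_add[of ?p "u ` J" "u j"] by (simp add: F_def hull_inc)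
  then obtain e where e: "e > 0" "?p + e *\<^sub>R (?p - (?p + u j)) \<in> F"
    using rel_interior_prolong[OF conv ri] by blast
  then have "0 \<le> (?p - e *\<^sub>R u j) \<bullet> w j"
    using j by (auto simp: face_eq)
  then show "0 < ?p \<bullet> w j"
    using e(1) j J_subset by (auto simp: inner_diff_left inner subset_iff)
qed

text \<open>At a relative interior point of \<open>F\<close> the constraints indexed by
  \<open>J\<close> are strict and survive a small step, while the others are tight and restrict the
  direction.\<close>

lemma tangent_cone_face: "tangent_cone F C = {x. \<forall>j\<in>I - J. 0 \<le> x \<bullet> w j}"
proof (intro equalityI subsetI CollectI ballI)
  fix x j assume x: "x \<in> tangent_cone F C" and j: "j \<in> I - J"
  then obtain e where "e > 0" "relint_point F + e *\<^sub>R x \<in> C"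
    by (auto simp: tangent_cone_def)
  then show "0 \<le> x \<bullet> w j"
    using j relint_point_face(2)[OF j] by (auto simp: cone_eq inner_left_distrib zero_le_mult_iff)
next
  fix x assume x: "x \<in> {x. \<forall>j\<in>I - J. 0 \<le> x \<bullet> w j}"
  let ?p = "relint_point F"
  \<comment> \<open>Finiteness of \<open>J\<close> yields one step size that works for all strict
    constraints.\<close>
  have "\<forall>\<^sub>F e in at_right 0. \<forall>j\<in>J. 0 < (?p + e *\<^sub>R x) \<bullet> w j"
  proof (rule eventually_ball_finite)
    show "finite J"
      using J_subset finite_I finite_subset by blast
    show "\<forall>j\<in>J. \<forall>\<^sub>F e in at_right 0. 0 < (?p + e *\<^sub>R x) \<bullet> w j"
    proof
      fix j assume "j \<in> J"
      have "((\<lambda>e. (?p + e *\<^sub>R x) \<bullet> w j) \<longlongrightarrow> (?p + 0 *\<^sub>R x) \<bullet> w j) (at_right 0)"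
        by (intro tendsto_intros)
      then show "\<forall>\<^sub>F e in at_right 0. 0 < (?p + e *\<^sub>R x) \<bullet> w j"
        using relint_point_face(1)[OF \<open>j \<in> J\<close>] by (simp add: order_tendstoD(1))
    qed
  qed
  with eventually_at_right_less[of "0::real"]
  have "\<forall>\<^sub>F e in at_right 0. 0 < e \<and> (\<forall>j\<in>J. 0 < (?p + e *\<^sub>R x) \<bullet> w j)"
    by (rule eventually_conj)
  then obtain e where e: "e > 0" "\<forall>j\<in>J. 0 < (?p + e *\<^sub>R x) \<bullet> w j"
    using eventually_happens trivial_limit_at_right_real by blast
  have "0 \<le> (?p + e *\<^sub>R x) \<bullet> w j" if "j \<in> I" for j
  proof (cases "j \<in> J")
    case False
    then show ?thesis
      using e(1) x that relint_point_face(2)[of j] by (auto simp: inner_left_distrib)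
  qed (use e(2) in force)
  then show "x \<in> tangent_cone F C"
    using e(1) by (auto simp: tangent_cone_def cone_eq)
qed

lemma lineality_space_tangent_cone: "lineality_space (tangent_cone F C) = span (u ` J)"
proof -
  have "convex_cone (tangent_cone F C)"
    by (auto simp: tangent_cone_face convex_cone_iff inner_left_distrib)
  then show ?thesis
    unfolding span_subfamily[OF card_I J_subset]
    by (force simp: lineality_space_convex_cone tangent_cone_face)
qed

text \<open>Complementary slackness: expanding \<open>z - relint_point F\<close> in the basis turns
  its inner product with \<open>x\<close> into a sum of coordinates times the numbers
  \<open>x \<bullet> u i\<close>.\<close>

lemma normal_cone_face:
  "normal_cone F C = {x. (\<forall>j\<in>J. x \<bullet> u j = 0) \<and> (\<forall>j\<in>I - J. x \<bullet> u j \<le> 0)}"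
proof -
  let ?p = "relint_point F"
  have expand_inner: "x \<bullet> z = (\<Sum>i\<in>I. (z \<bullet> w i) * (x \<bullet> u i))" for x z
  proof -
    have "z = (\<Sum>i\<in>I. (z \<bullet> w i) *\<^sub>R u i)"
      by (rule expand) (simp add: span_UNIV card_I)
    then have "x \<bullet> z = x \<bullet> (\<Sum>i\<in>I. (z \<bullet> w i) *\<^sub>R u i)"
      by (rule arg_cong)
    then show ?thesis by (simp add: inner_sum_right)
  qed
  have p: "?p \<in> C"
    unfolding cone_eq
  proof (intro CollectI ballI)
    fix j assume "j \<in> I"
    then show "0 \<le> ?p \<bullet> w j"
      using relint_point_face[of j] by (cases "j \<in> J") auto
  qed
  have u: "u j \<in> C" if "j \<in> I" for j
    using that by (auto simp: C_def intro: hull_inc)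
  show ?thesis
  proof (intro equalityI subsetI)
    fix x assume "x \<in> normal_cone F C"
    then have x: "x \<bullet> (z - ?p) \<le> 0" if "z \<in> C" for z
      using that by (auto simp: normal_cone_def)
    have nonpos: "x \<bullet> u j \<le> 0" if "j \<in> I" for j
      using x[of "?p + u j"] convex_cone_hull_add[of ?p "u ` I" "u j"] p u[OF that]
      by (simp add: C_def)
    \<comment> \<open>Testing with the apex bounds \<open>x \<bullet> ?p\<close> from below, yet
      every summand of its expansion is nonpositive. Hence all summands vanish, and
      \<open>?p \<bullet> w j > 0\<close> forces \<open>x \<bullet> u j = 0\<close> for
      \<open>j\<close> in \<open>J\<close>.\<close>
    have "0 \<le> x \<bullet> ?p"
      using x[of 0] convex_cone_hull_contains_0[of "u ` I"] by (simp add: C_def)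
    then have sum: "0 \<le> (\<Sum>i\<in>I. (?p \<bullet> w i) * (x \<bullet> u i))"
      by (simp only: expand_inner[of x ?p])
    have terms: "(?p \<bullet> w i) * (x \<bullet> u i) \<le> 0" if "i \<in> I" for i
      using p nonpos[OF that] that by (auto simp: cone_eq mult_nonneg_nonpos)
    then have "(\<Sum>i\<in>I. (?p \<bullet> w i) * (x \<bullet> u i)) = 0"
      using sum by (intro antisym sum_nonpos)
    then have "(?p \<bullet> w i) * (x \<bullet> u i) = 0" if "i \<in> I" for i
      using that terms sum_nonneg_eq_0_iff[OF finite_I, of "\<lambda>i. - ((?p \<bullet> w i) * (x \<bullet> u i))"]
      by (simp add: sum_negf)
    then have "x \<bullet> u j = 0" if "j \<in> J" for j
      using that relint_point_face(1)[OF that] J_subset by force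
    then show "x \<in> {x. (\<forall>j\<in>J. x \<bullet> u j = 0) \<and> (\<forall>j\<in>I - J. x \<bullet> u j \<le> 0)}"
      using nonpos by simp
  next
    fix x assume x: "x \<in> {x. (\<forall>j\<in>J. x \<bullet> u j = 0) \<and> (\<forall>j\<in>I - J. x \<bullet> u j \<le> 0)}"
    have "((z - ?p) \<bullet> w i) * (x \<bullet> u i) \<le> 0" if "z \<in> C" "i \<in> I" for z i
      using that x relint_point_face(2)[of i]
      by (cases "i \<in> J") (auto simp: cone_eq inner_diff_left mult_nonneg_nonpos)
    then have "x \<bullet> (z - ?p) \<le> 0" if "z \<in> C" for z
      unfolding expand_inner[of x "z - ?p"] using that by (auto intro!: sum_nonpos)
    then show "x \<in> normal_cone F C"
      by (simp add: normal_cone_def)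
  qed
qed

end

section \<open>Uniqueness of orthocentric cones\<close>

lemma isometric_cones_refl: "isometric_cones A A"
  unfolding isometric_cones_def by (rule exI[of _ id]) (auto simp: linear_id)

text \<open>Equal Gram matrices: the linear map taking one family to the other preserves inner
  products on the span. This carries an isometry from one realisation to all, also in another
  ambient space.\<close>

lemma orthocentric_cone_unique:
  assumes "orthocentric_cone m l0 l e A" and "orthocentric_cone m l0 l e B"
  shows "isometric_cones A B"
proof -
  obtain u where u: "orthocentric_family m l0 l u"
    and A: "A = convex_cone hull ((\<lambda>i. e i *\<^sub>R u i) ` {1..m})"
    using assms(1) unfolding orthocentric_cone_def by blast
  obtain u' where u': "orthocentric_family m l0 l u'"
    and B: "B = convex_cone hull ((\<lambda>i. e i *\<^sub>R u' i) ` {1..m})"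
    using assms(2) unfolding orthocentric_cone_def by blast
  have inj: "inj_on u {1..m}" and indep: "independent (u ` {1..m})"
    using u unfolding orthocentric_family_def by blast+
  obtain f where f: "linear f" "\<forall>x\<in>u ` {1..m}. f x = u' (the_inv_into {1..m} u x)"
    using linear_independent_extend[OF indep, of "\<lambda>x. u' (the_inv_into {1..m} u x)"] by (elim exE conjE)
  have fu: "f (u i) = u' i" if "i \<in> {1..m}" for i
    using f(2) that by (metis imageI inj the_inv_into_f_f)
  have gram: "u' i \<bullet> u' j = u i \<bullet> u j" if "i \<in> {1..m}" "j \<in> {1..m}" for i j
    using u u' that by (simp add: orthocentric_family_def)
  have "norm (f x) = norm x" if "x \<in> span A" for x
  proof -
    have "A \<subseteq> span (u ` {1..m})"
      unfolding A by (rule hull_minimal) (auto simp: convex_cone_span intro: span_scale span_base)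
    then have "x \<in> span (u ` {1..m})"
      using that span_minimal subspace_span by blast
    then obtain c where "x = (\<Sum>y\<in>u ` {1..m}. c y *\<^sub>R y)"
      by (auto simp: span_finite)
    then have x: "x = (\<Sum>i\<in>{1..m}. c (u i) *\<^sub>R u i)"
      unfolding sum.reindex[OF inj] o_def .
    have fx: "f x = (\<Sum>i\<in>{1..m}. c (u i) *\<^sub>R u' i)"
      unfolding x linear_sum[OF f(1)] linear_scale[OF f(1)] using fu by (intro sum.cong) simp_all
    have "f x \<bullet> f x = x \<bullet> x"
      unfolding fx unfolding x inner_sum_left inner_sum_right inner_scaleR_left inner_scaleR_right
      using gram by (intro sum.cong) auto
    then show ?thesis
      by (simp add: norm_eq_sqrt_inner)
  qed
  moreover have "f ` (\<lambda>i. e i *\<^sub>R u i) ` {1..m} = (\<lambda>i. e i *\<^sub>R u' i) ` {1..m}"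
    unfolding image_image using fu by (intro image_cong) (simp_all add: linear_scale[OF f(1)])
  then have "f ` A = B"
    using convex_cone_hull_linear_image[OF f(1)] by (metis A B)
  ultimately show ?thesis
    unfolding isometric_cones_def using f(1) by blast
qed

lemma image_shift_atLeastAtMost: "(\<lambda>i. g (k + i)) ` {1..d - k} = g ` {k + 1..d}" for k d :: nat
proof -
  have "(+) k ` {1..d - k} = {k + 1..d}"
    by (cases "k \<le> d") (auto simp: image_add_atLeastAtMost)
  then show ?thesis by (metis image_image)
qed

text \<open>Reindexes generators from \<open>{k + 1..d}\<close> to \<open>{1..d - k}\<close>;
  biorthogonality supplies injectivity and linear independence.\<close>

lemma orthocentric_cone_shift:
  fixes u :: "nat \<Rightarrow> 'a::euclidean_space"
  assumes "l0 \<noteq> 0" "\<forall>i\<in>{k + 1..d}. l i \<noteq> 0" "\<forall>i\<in>{k + 1..d}. e i \<in> {1, -1}"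
    and dual: "biorthogonal {k + 1..d} (\<lambda>i. e i *\<^sub>R u i) z"
    and "\<forall>i\<in>{k + 1..d}. \<forall>j\<in>{k + 1..d}. u i \<bullet> u j = 1 / l0 + (if i = j then 1 / l i else 0)"
  shows "orthocentric_cone (d - k) l0 (\<lambda>i. l (k + i)) (\<lambda>i. e (k + i))
    (convex_cone hull ((\<lambda>i. e i *\<^sub>R u i) ` {k + 1..d}))"
proof -
  have *: "k + i \<in> {k + 1..d}" if "i \<in> {1..d - k}" for i
    using that by auto
  \<comment> \<open>As the signs square to 1, they can be moved from the generators to the dual
    vectors.\<close>
  interpret biorthogonal "{k + 1..d}" u "\<lambda>j. e j *\<^sub>R z j"
  proof
    fix i j assume "i \<in> {k + 1..d}" "j \<in> {k + 1..d}"
    moreover from this have "e i * (u i \<bullet> z j) = (if i = j then 1 else 0)"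
      using biorthogonal.inner[OF dual, of i j] by simp
    moreover have "e i = 1 \<or> e i = - 1"
      using assms(3) calculation(1) by blast
    ultimately show "u i \<bullet> e j *\<^sub>R z j = (if i = j then 1 else 0)"
      by (cases "i = j") auto
  qed simp
  have "inj_on (\<lambda>i. u (k + i)) {1..d - k}"
  proof (rule inj_onI)
    fix i j assume "i \<in> {1..d - k}" "j \<in> {1..d - k}" "u (k + i) = u (k + j)"
    then show "i = j"
      using inj_onD[OF inj, of "k + i" "k + j"] * by simp
  qed
  moreover have "independent ((\<lambda>i. u (k + i)) ` {1..d - k})"
    unfolding image_shift_atLeastAtMost by (rule independent)
  ultimately have "orthocentric_family (d - k) l0 (\<lambda>i. l (k + i)) (\<lambda>i. u (k + i))"
    unfolding orthocentric_family_def using assms(1,2,5) * by auto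
  moreover have "(\<lambda>i. e i *\<^sub>R u i) ` {k + 1..d} = (\<lambda>i. e (k + i) *\<^sub>R u (k + i)) ` {1..d - k}"
    by (simp only: image_shift_atLeastAtMost[of "\<lambda>i. e i *\<^sub>R u i"])
  moreover have "\<forall>i\<in>{1..d - k}. e (k + i) \<in> {1, - 1}"
    using assms(3) * by blast
  ultimately show ?thesis
    unfolding orthocentric_cone_def by (intro conjI exI[of _ "\<lambda>i. u (k + i)"]) simp_all
qed

section \<open>Vectors with an orthocentric Gram matrix\<close>

lemma span_image_scale_units:
  fixes v :: "'i \<Rightarrow> 'a::real_vector"
  assumes "\<And>i. i \<in> I \<Longrightarrow> c i \<noteq> (0::real)"
  shows "span ((\<lambda>i. c i *\<^sub>R v i) ` I) = span (v ` I)"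
proof (rule span_eq[THEN iffD2], intro conjI subsetI)
  fix x assume "x \<in> v ` I"
  then obtain i where i: "i \<in> I" "x = v i" by blast
  then have "inverse (c i) *\<^sub>R (c i *\<^sub>R v i) \<in> span ((\<lambda>i. c i *\<^sub>R v i) ` I)"
    by (intro span_scale span_base) simp
  then show "x \<in> span ((\<lambda>i. c i *\<^sub>R v i) ` I)"
    using i assms by simp
qed (auto intro: span_scale span_base)

locale orthocentric_vectors =
  fixes v :: "nat \<Rightarrow> 'a::euclidean_space" and l0 :: real and l :: "nat \<Rightarrow> real" and d :: nat
  assumes orthocentric: "orthocentric_family d l0 l v"
begin

lemma l0_nonzero: "l0 \<noteq> 0"
  and l_nonzero: "i \<in> {1..d} \<Longrightarrow> l i \<noteq> 0"
  and inj_v: "inj_on v {1..d}"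
  and independent_v: "independent (v ` {1..d})"
  and gram: "i \<in> {1..d} \<Longrightarrow> j \<in> {1..d} \<Longrightarrow> v i \<bullet> v j = 1 / l0 + (if i = j then 1 / l i else 0)"
  using orthocentric unfolding orthocentric_family_def by blast+

definition s :: "nat \<Rightarrow> real" where
  "s k = l0 + (\<Sum>i=1..k. l i)"

text \<open>For \<open>k = d\<close> no \<open>v j\<close> is left to project; \<open>w d\<close> is
  then the vector whose inner product with every \<open>v j\<close> is
  \<open>1 / l0\<close>.\<close>

definition w :: "nat \<Rightarrow> 'a" where
  "w k = (1 / s k) *\<^sub>R (\<Sum>i=1..k. l i *\<^sub>R v i)"

lemma inner_weighted_sum:
  assumes "k \<le> d" "j \<in> {1..d}"
  shows "(\<Sum>i=1..k. l i *\<^sub>R v i) \<bullet> v j = (s k - l0) / l0 + (if j \<le> k then 1 else 0)"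
proof -
  have "(\<Sum>i=1..k. l i *\<^sub>R v i) \<bullet> v j = (\<Sum>i=1..k. l i / l0 + (if i = j then 1 else 0))"
    unfolding inner_sum_left inner_scaleR_left
    using assms l_nonzero by (intro sum.cong) (auto simp: gram distrib_left)
  also have "\<dots> = (\<Sum>i=1..k. l i) / l0 + (if j \<le> k then 1 else 0)"
    using assms by (simp add: sum.distrib sum_divide_distrib)
  finally show ?thesis by (simp add: s_def)
qed

lemma s_nonzero:
  assumes "k \<le> d"
  shows "s k \<noteq> 0"
proof
  assume s0: "s k = 0"
  then have k: "1 \<in> {1..k}"
    using l0_nonzero by (cases k) (auto simp: s_def)
  let ?y = "\<Sum>i=1..k. l i *\<^sub>R v i"
  \<comment> \<open>With \<open>s k = 0\<close> the term \<open>(s k - l0) / l0\<close> is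
    \<open>-1\<close> and cancels the \<open>1\<close>, so \<open>?y\<close> is orthogonal to its
    own summands.\<close>
  have "?y \<bullet> v i = 0" if "i \<in> {1..k}" for i
    using that assms l0_nonzero by (subst inner_weighted_sum) (auto simp: s0)
  moreover have "?y \<bullet> ?y = (\<Sum>i=1..k. l i * (?y \<bullet> v i))"
    by (simp only: inner_sum_right inner_scaleR_right)
  ultimately have "?y \<bullet> ?y = 0" by simp
  then have "?y = 0" by simp
  have inj: "inj_on v {1..k}"
    using inj_v assms by (auto intro: inj_on_subset)
  \<comment> \<open>The sum over indices becomes a sum over vectors, to which linear independence
    applies; it would force \<open>l 1 = 0\<close>.\<close>
  have "(\<Sum>x\<in>v ` {1..k}. l (the_inv_into {1..k} v x) *\<^sub>R x) = ?y"
    unfolding sum.reindex[OF inj] o_def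
    by (intro sum.cong refl) (simp only: the_inv_into_f_f[OF inj])
  then have "l (the_inv_into {1..k} v (v 1)) = 0"
    using \<open>?y = 0\<close> k assms
    by (intro independentD[OF independent_v, of "v ` {1..k}" "\<lambda>x. l (the_inv_into {1..k} v x)"]) auto
  then show False
    using l_nonzero[of 1] k assms unfolding the_inv_into_f_f[OF inj k] by simp
qed

text \<open>For \<open>j \<le> k\<close> the value agrees with \<open>v i \<bullet> v j\<close> for
  all \<open>i\<close> in \<open>{k + 1..d}\<close>; this is the projection property of
  \<open>w k\<close>.\<close>

lemma inner_w_v:
  assumes "k \<le> d" "j \<in> {1..d}"
  shows "w k \<bullet> v j = 1 / l0 - (if j \<le> k then 0 else 1 / s k)"
  using s_nonzero[OF assms(1)] l0_nonzero inner_weighted_sum[OF assms]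
  by (simp add: w_def diff_divide_distrib add_divide_distrib)

text \<open>Only the smaller index matters, since \<open>w k\<close> has inner product
  \<open>1 / l0\<close> with each \<open>v i\<close> occurring in \<open>w m\<close>.\<close>

lemma inner_w_w:
  assumes "m \<le> k" "k \<le> d"
  shows "w m \<bullet> w k = 1 / l0 - 1 / s m"
proof -
  have "w m \<bullet> w k = (1 / s m) * (\<Sum>i=1..m. l i * (w k \<bullet> v i))"
    unfolding w_def[of m] inner_scaleR_left inner_sum_left by (simp add: inner_commute)
  also have "(\<Sum>i=1..m. l i * (w k \<bullet> v i)) = (\<Sum>i=1..m. l i / l0)"
    using assms by (intro sum.cong) (simp_all add: inner_w_v)
  also have "(1 / s m) * \<dots> = 1 / l0 - 1 / s m"
  proof -
    have "(\<Sum>i=1..m. l i / l0) = (s m - l0) / l0"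
      by (simp add: s_def sum_divide_distrib)
    then show ?thesis
      using s_nonzero[of m] assms l0_nonzero by (simp add: field_simps)
  qed
  finally show ?thesis .
qed

text \<open>Projecting out \<open>w k\<close> lowers every entry by
  \<open>w k \<bullet> w k = 1 / l0 - 1 / s k\<close>, which turns the constant
  \<open>1 / l0\<close> into \<open>1 / s k\<close>.\<close>

lemma gram_tangent:
  assumes "k \<le> d" "i \<in> {k + 1..d}" "j \<in> {k + 1..d}"
  shows "(v i - w k) \<bullet> (v j - w k) = 1 / s k + (if i = j then 1 / l i else 0)"
  using assms inner_w_v[of k i] inner_w_v[of k j] gram[of i j] inner_w_w[of k k]
  by (auto simp: inner_diff_left inner_diff_right inner_commute[of "v _" "w _"])

text \<open>Both cross terms are \<open>1 / l0\<close> and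
  \<open>w d \<bullet> w d = 1 / l0 - 1 / s d\<close>, so the constant that remains is
  \<open>- 1 / s d\<close>: the source of the negated total in the normal cone.\<close>

lemma gram_normal:
  assumes "i \<in> {1..d}" "j \<in> {1..d}"
  shows "(w d - v i) \<bullet> (w d - v j) = 1 / (- s d) + (if i = j then 1 / l i else 0)"
  using assms inner_w_v[of d i] inner_w_v[of d j] gram[of i j] inner_w_w[of d d]
  by (auto simp: inner_diff_left inner_diff_right inner_commute[of "v _" "w _"])

lemma inner_dual:
  assumes "i \<in> {1..d}" "j \<in> {1..d}"
  shows "v i \<bullet> (v j - w d) = (if i = j then 1 / l i else 0)"
  using assms inner_w_v[of d i] gram[of i j]
  by (auto simp: inner_diff_right inner_commute[of "v _" "w _"])

text \<open>\<open>w k\<close> lies in the span of \<open>v 1, \<dots>, v k\<close>, so its dual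
  coordinates beyond \<open>k\<close> vanish.\<close>

lemma inner_w_dual:
  assumes "k \<le> d" "j \<in> {k + 1..d}"
  shows "w k \<bullet> (v j - w d) = 0"
  using assms inner_w_v[of k j] inner_w_w[of k d]
  by (auto simp: inner_diff_right)

lemma inner_tangent_v:
  assumes "k \<le> d" "i \<in> {k + 1..d}" "j \<in> {1..k}"
  shows "(v i - w k) \<bullet> v j = 0"
  using assms inner_w_v[of k j] gram[of i j] by (auto simp: inner_diff_left)

end

locale orthocentric_vectors_signs = orthocentric_vectors +
  fixes e :: "nat \<Rightarrow> real"
  assumes signs: "\<forall>i\<in>{1..d}. e i \<in> {1, -1}"
begin

lemma sign_square: "i \<in> {1..d} \<Longrightarrow> e i * e i = 1"
  using bspec[OF signs, of i] by auto

lemma biorthogonal_dual: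
  "biorthogonal {1..d} (\<lambda>i. e i *\<^sub>R v i) (\<lambda>j. (e j * l j) *\<^sub>R (v j - w d))"
proof
  fix i j assume ij: "i \<in> {1..d}" "j \<in> {1..d}"
  show "(e i *\<^sub>R v i) \<bullet> ((e j * l j) *\<^sub>R (v j - w d)) = (if i = j then 1 else 0)"
    unfolding inner_scaleR_left inner_scaleR_right inner_dual[OF ij]
    using sign_square[OF ij(1)] l_nonzero[OF ij(1)] by auto
qed simp

text \<open>The roles are exchanged: multiples of the dual vectors generate and the
  \<open>v j\<close> test. The factor \<open>l j\<close> is split so that its sign goes to the
  generator, while the test vector is a negative multiple of
  \<open>e j *\<^sub>R v j\<close>.\<close>

lemma biorthogonal_normal:
  "biorthogonal {1..d} (\<lambda>i. (e i * sgn (l i)) *\<^sub>R (w d - v i)) (\<lambda>j. (- (e j * \<bar>l j\<bar>)) *\<^sub>R v j)"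
proof
  fix i j assume ij: "i \<in> {1..d}" "j \<in> {1..d}"
  have "(w d - v i) \<bullet> v j = - (if i = j then 1 / l i else 0)"
    using inner_dual[OF ij(2,1)] by (auto simp: inner_diff_left inner_diff_right inner_commute)
  then show "((e i * sgn (l i)) *\<^sub>R (w d - v i)) \<bullet> ((- (e j * \<bar>l j\<bar>)) *\<^sub>R v j) = (if i = j then 1 else 0)"
    unfolding inner_scaleR_left inner_scaleR_right
    using sign_square[OF ij(1)] l_nonzero[OF ij(1)] by (auto simp: sgn_if)
qed simp

text \<open>Subtracting \<open>w k\<close> leaves the coordinates beyond \<open>k\<close> unchanged,
  so the dual vectors of the original generators still serve.\<close>

lemma biorthogonal_tangent:
  assumes "k \<le> d"
  shows "biorthogonal {k + 1..d} (\<lambda>i. e i *\<^sub>R (v i - w k)) (\<lambda>j. (e j * l j) *\<^sub>R (v j - w d))"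
proof
  fix i j assume ij: "i \<in> {k + 1..d}" "j \<in> {k + 1..d}"
  then have ij': "i \<in> {1..d}" "j \<in> {1..d}" by auto
  have "(v i - w k) \<bullet> (v j - w d) = (if i = j then 1 / l i else 0)"
    using inner_dual[OF ij'] inner_w_dual[OF assms ij(2)] by (simp add: inner_diff_left)
  then show "(e i *\<^sub>R (v i - w k)) \<bullet> ((e j * l j) *\<^sub>R (v j - w d)) = (if i = j then 1 else 0)"
    unfolding inner_scaleR_left inner_scaleR_right
    using sign_square[OF ij'(1)] l_nonzero[OF ij'(1)] by auto
qed simp

end

theorem theorem4p3:
  fixes v :: "nat \<Rightarrow> 'a::euclidean_space"
    and l0 :: real and l \<epsilon> :: "nat \<Rightarrow> real"
    and d k :: nat and C F :: "'a set"
  assumes "d = DIM('a)"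
    and "inj_on v {1..d}" and "independent (v ` {1..d})"
    and "l0 \<noteq> 0" and "\<forall>i\<in>{1..d}. l i \<noteq> 0"
    and "\<forall>i\<in>{1..d}. \<forall>j\<in>{1..d}. v i \<bullet> v j = 1 / l0 + (if i = j then 1 / l i else 0)"
    and "\<forall>i\<in>{1..d}. \<epsilon> i \<in> {1, -1}"
    and "C = convex_cone hull ((\<lambda>i. \<epsilon> i *\<^sub>R v i) ` {1..d})"
    and "k \<in> {1..d - 1}"
    and "F = convex_cone hull ((\<lambda>i. \<epsilon> i *\<^sub>R v i) ` {1..k})"
  shows "F face_of C \<and>
    \<comment> \<open>the target cone exists, and the normal cone is isometric to every realisation of it,
        in whichever Euclidean space \<open>'b\<close>; likewise for \<open>D\<close> below\<close>
    (\<exists>K::'a set. orthocentric_cone (d - k) (- l0 - (\<Sum>i=1..d. l i)) (\<lambda>i. l (k + i))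
        (\<lambda>i. \<epsilon> (k + i) * sgn (l (k + i))) K \<and> isometric_cones (normal_cone F C) K) \<and>
    (\<forall>K::'b::euclidean_space set.
        orthocentric_cone (d - k) (- l0 - (\<Sum>i=1..d. l i)) (\<lambda>i. l (k + i))
          (\<lambda>i. \<epsilon> (k + i) * sgn (l (k + i))) K
        \<longrightarrow> isometric_cones (normal_cone F C) K) \<and>
    lineality_space (tangent_cone F C) = span (v ` {1..k}) \<and>
    (\<exists>D. direct_orthogonal_sum (tangent_cone F C) (span (v ` {1..k})) D \<and> pointed_cone D \<and>
      (\<exists>K::'a set. orthocentric_cone (d - k) (l0 + (\<Sum>i=1..k. l i)) (\<lambda>i. l (k + i))
          (\<lambda>i. \<epsilon> (k + i)) K \<and> isometric_cones D K) \<and>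
      (\<forall>K::'b set.
          orthocentric_cone (d - k) (l0 + (\<Sum>i=1..k. l i)) (\<lambda>i. l (k + i))
            (\<lambda>i. \<epsilon> (k + i)) K
          \<longrightarrow> isometric_cones D K))"
proof -
  have kd: "k \<le> d" and range_diff: "{1..d} - {1..k} = {k + 1..d}"
    and range_diff': "{1..d} - {k + 1..d} = {1..k}"
    and sub: "{1..k} \<subseteq> {1..d}" "{k + 1..d} \<subseteq> {1..d}" and card_d: "card {1..d} = DIM('a)"
    using assms(1,9) by auto
  interpret orthocentric_vectors_signs v l0 l d \<epsilon>
    by unfold_locales (use assms in \<open>simp_all add: orthocentric_family_def\<close>)
  let ?b' = "\<lambda>j. (\<epsilon> j * l j) *\<^sub>R (v j - w d)"
  interpret biorthogonal "{1..d}" "\<lambda>i. \<epsilon> i *\<^sub>R v i" ?b'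
    by (rule biorthogonal_dual)
  interpret simplicial_cone "{1..d}" "\<lambda>i. \<epsilon> i *\<^sub>R v i" ?b' "{1..k}" C F
    using assms(8,10) sub card_d by unfold_locales
  have sign_nonzero: "\<epsilon> i \<noteq> 0" if "i \<in> {1..d}" for i
    using sign_square[OF that] by auto
  let ?L = "span (v ` {1..k})"
  have L_eq: "span ((\<lambda>i. \<epsilon> i *\<^sub>R v i) ` {1..k}) = ?L"
    by (rule span_image_scale_units) (use sign_nonzero kd in auto)

  \<comment> \<open>The normal cone and its generators\<close>
  define N where "N = convex_cone hull ((\<lambda>i. (\<epsilon> i * sgn (l i)) *\<^sub>R (w d - v i)) ` {k + 1..d})"
  have N_eq: "normal_cone F C = N"
  proof -
    interpret normal: biorthogonal "{1..d}" "\<lambda>i. (\<epsilon> i * sgn (l i)) *\<^sub>R (w d - v i)"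
        "\<lambda>j. (- (\<epsilon> j * \<bar>l j\<bar>)) *\<^sub>R v j"
      by (rule biorthogonal_normal)
    have scaled: "x \<bullet> (- (\<epsilon> j * \<bar>l j\<bar>)) *\<^sub>R v j = - \<bar>l j\<bar> * (x \<bullet> \<epsilon> j *\<^sub>R v j)" for x j
      by simp
    \<comment> \<open>The test vectors are negative multiples of the generators of \<open>C\<close>,
      so nonnegativity against them is the sign condition of
      \<open>normal_cone_face\<close>.\<close>
    have "0 \<le> x \<bullet> (- (\<epsilon> j * \<bar>l j\<bar>)) *\<^sub>R v j \<longleftrightarrow> x \<bullet> \<epsilon> j *\<^sub>R v j \<le> 0"
      and "x \<bullet> (- (\<epsilon> j * \<bar>l j\<bar>)) *\<^sub>R v j = 0 \<longleftrightarrow> x \<bullet> \<epsilon> j *\<^sub>R v j = 0"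
      if "j \<in> {1..d}" for x j
      using l_nonzero[OF that] unfolding scaled
      by (simp_all only: zero_le_mult_iff mult_eq_0_iff) auto
    then show ?thesis
      unfolding N_def normal.convex_cone_hull_subfamily[OF card_d sub(2)] normal_cone_face
        range_diff range_diff'
      using sub by blast
  qed
  have s_d: "- l0 - (\<Sum>i=1..d. l i) = - s d" and s_k: "l0 + (\<Sum>i=1..k. l i) = s k"
    by (simp_all add: s_def)
  have N: "orthocentric_cone (d - k) (- s d) (\<lambda>i. l (k + i)) (\<lambda>i. \<epsilon> (k + i) * sgn (l (k + i))) N"
    unfolding N_def
  proof (rule orthocentric_cone_shift[where e = "\<lambda>i. \<epsilon> i * sgn (l i)"])
    show "\<forall>i\<in>{k + 1..d}. \<epsilon> i * sgn (l i) \<in> {1, - 1}"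
      using signs l_nonzero sub(2) by (force simp: sgn_if)
    show "\<forall>i\<in>{k + 1..d}. \<forall>j\<in>{k + 1..d}.
        (w d - v i) \<bullet> (w d - v j) = 1 / - s d + (if i = j then 1 / l i else 0)"
      using gram_normal sub(2) by blast
    show "biorthogonal {k + 1..d} (\<lambda>i. (\<epsilon> i * sgn (l i)) *\<^sub>R (w d - v i))
        (\<lambda>j. (- (\<epsilon> j * \<bar>l j\<bar>)) *\<^sub>R v j)"
      by (rule biorthogonal.subfamily[OF biorthogonal_normal sub(2)])
  qed (use s_nonzero[of d] l_nonzero sub(2) in auto)

  \<comment> \<open>The pointed summand of the tangent cone\<close>
  define D where "D = convex_cone hull ((\<lambda>i. \<epsilon> i *\<^sub>R (v i - w k)) ` {k + 1..d})"
  interpret tangent: biorthogonal "{k + 1..d}" "\<lambda>i. \<epsilon> i *\<^sub>R (v i - w k)" ?b'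
    by (rule biorthogonal_tangent[OF kd])
  have D: "orthocentric_cone (d - k) (s k) (\<lambda>i. l (k + i)) (\<lambda>i. \<epsilon> (k + i)) D"
    unfolding D_def
  proof (rule orthocentric_cone_shift)
    show "\<forall>i\<in>{k + 1..d}. \<epsilon> i \<in> {1, - 1}"
      using signs sub(2) by blast
    show "\<forall>i\<in>{k + 1..d}. \<forall>j\<in>{k + 1..d}.
        (v i - w k) \<bullet> (v j - w k) = 1 / s k + (if i = j then 1 / l i else 0)"
      using gram_tangent[OF kd] by blast
    show "biorthogonal {k + 1..d} (\<lambda>i. \<epsilon> i *\<^sub>R (v i - w k)) ?b'"
      by (rule biorthogonal_tangent[OF kd])
  qed (use s_nonzero[OF kd] l_nonzero sub(2) in auto)

  \<comment> \<open>Orthogonal decomposition of the tangent cone\<close>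
  have D_eq: "D = {x \<in> span ((\<lambda>i. \<epsilon> i *\<^sub>R (v i - w k)) ` {k + 1..d}). \<forall>j\<in>{k + 1..d}. 0 \<le> x \<bullet> ?b' j}"
    unfolding D_def by (rule tangent.convex_cone_hull_eq)
  have L: "?L = {x. \<forall>j\<in>{k + 1..d}. x \<bullet> ?b' j = 0}"
    using span_subfamily[OF card_d sub(1)] unfolding L_eq range_diff .
  have T: "tangent_cone F C = {x. \<forall>j\<in>{k + 1..d}. 0 \<le> x \<bullet> ?b' j}"
    using tangent_cone_face unfolding range_diff .
  have orth: "x \<bullet> y = 0" if "x \<in> ?L" "y \<in> D" for x y
  proof -
    have "orthogonal y x"
    proof (rule orthogonal_to_span[OF that(1)])
      fix z assume "z \<in> v ` {1..k}"
      then obtain j where j: "j \<in> {1..k}" "z = v j" by blast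
      have "orthogonal z y"
      proof (rule orthogonal_to_span)
        show "y \<in> span ((\<lambda>i. \<epsilon> i *\<^sub>R (v i - w k)) ` {k + 1..d})"
          using that(2) by (simp add: D_eq)
        fix y' assume "y' \<in> (\<lambda>i. \<epsilon> i *\<^sub>R (v i - w k)) ` {k + 1..d}"
        then obtain i where i: "i \<in> {k + 1..d}" "y' = \<epsilon> i *\<^sub>R (v i - w k)" by blast
        show "orthogonal z y'"
          using inner_tangent_v[OF kd i(1) j(1)] unfolding orthogonal_def i(2) j(2)
          by (simp add: inner_commute)
      qed
      then show "orthogonal y z" by (simp add: orthogonal_commute)
    qed
    then show ?thesis by (simp add: orthogonal_def inner_commute)
  qed
  have "bij_betw (\<lambda>(x, y). x + y) (?L \<times> D) (tangent_cone F C)"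
    unfolding bij_betw_def
  proof
    show "inj_on (\<lambda>(x, y). x + y) (?L \<times> D)"
    proof (rule inj_onI, clarify)
      fix x y x' y' assume xy: "x \<in> ?L" "x' \<in> ?L" "y \<in> D" "y' \<in> D" "x + y = x' + y'"
      \<comment> \<open>The two factors are the same vector, so it is orthogonal to itself and
        vanishes.\<close>
      have "(x - x') \<bullet> (y' - y) = 0"
        using orth[OF span_diff[OF xy(1,2)]] xy(3,4) by (simp add: inner_diff_right)
      moreover have "y' - y = x - x'"
        using xy(5) by (simp add: algebra_simps)
      ultimately show "x = x' \<and> y = y'"
        using xy(5) by simp
    qed
    show "(\<lambda>(x, y). x + y) ` (?L \<times> D) = tangent_cone F C"
    proof (intro equalityI subsetI)
      fix t assume "t \<in> (\<lambda>(x, y). x + y) ` (?L \<times> D)"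
      then obtain x y where "x \<in> ?L" "y \<in> D" "t = x + y" by auto
      then show "t \<in> tangent_cone F C"
        unfolding L D_eq T by (simp add: inner_add_left del: inner_scaleR_right)
    next
      fix t assume t: "t \<in> tangent_cone F C"
      \<comment> \<open>The \<open>D\<close>-component of \<open>t\<close> is built from its
        coordinates beyond \<open>k\<close>; the remainder then has these coordinates equal to 0 and
        lies in \<open>?L\<close>.\<close>
      let ?y = "\<Sum>j\<in>{k + 1..d}. (t \<bullet> ?b' j) *\<^sub>R (\<epsilon> j *\<^sub>R (v j - w k))"
      have y: "?y \<bullet> ?b' j = t \<bullet> ?b' j" if "j \<in> {k + 1..d}" for j
        by (rule tangent.inner_sum_left[OF that])
      have "?y \<in> span ((\<lambda>i. \<epsilon> i *\<^sub>R (v i - w k)) ` {k + 1..d})"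
        \<comment> \<open>The pattern peels off only the outer scalar, keeping the signed generators
          intact.\<close>
        by (intro span_sum span_scale[of "_ *\<^sub>R _"] span_base imageI)
      moreover have "0 \<le> ?y \<bullet> ?b' j" if "j \<in> {k + 1..d}" for j
        unfolding y[OF that] using t that unfolding T by blast
      ultimately have "?y \<in> D"
        unfolding D_eq by blast
      moreover have "t - ?y \<in> ?L"
        unfolding L using y by (intro CollectI ballI) (simp only: inner_diff_left diff_self)
      ultimately show "t \<in> (\<lambda>(x, y). x + y) ` (?L \<times> D)"
        by (intro image_eqI[of _ _ "(t - ?y, ?y)"]) auto
    qed
  qed
  then have sum: "direct_orthogonal_sum (tangent_cone F C) ?L D"
    using orth by (simp add: direct_orthogonal_sum_def)
  have pointed: "pointed_cone D"
    unfolding D_def by (rule tangent.pointed)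
  \<comment> \<open>\<open>N\<close> and \<open>D\<close> are themselves realisations, which settles
    existence; uniqueness up to isometry handles every other one.\<close>
  show ?thesis
    unfolding s_d s_k N_eq
    using face_of_cone lineality_space_tangent_cone[unfolded L_eq] sum pointed
      N D isometric_cones_refl orthocentric_cone_unique[OF N] orthocentric_cone_unique[OF D]
    by blast
qed

end
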